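(* Let $\mathcal{C}=C_1\wedge\cdots\wedge C_m$ be a CNF formula in Boolean variables $y_1,\dots,y_n$, where $C_i=\bigvee_{j\in P_i}y_j\vee\bigvee_{j\in N_i}\neg y_j$ with $P_i,N_i\subseteq\{1,\dots,n\}$. Define the crisp data $a^+_{ij}=1$ if $j\in P_i$ and $a^+_{ij}=0$ otherwise, $a^-_{ij}=1$ if $j\in N_i$ and $a^-_{ij}=0$ otherwise, and $b_i=1$ for $i=1,\dots,m$. Then for every t-norm $\varphi$ (not necessarily continuous) and every $y\in\{0,1\}^n$, $y$ satisfies $\mathcal{C}$ if and only if $$\max_{1\le j\le n}\max\{\varphi(a^+_{ij},y_j),\varphi(a^-_{ij},1-y_j)\}=b_i\quad\text{for all } i=1,\dots,m.$$ In particular, for every continuous t-norm $\varphi$ and every cost vector $c\in\mathbb{R}_{\ge 0}^n$, the classical minimum-weight satisfiability problem $\min\{c^Ty: y\in\{0,1\}^n,\ y\models\mathcal{C}\}$ is a crisp special case of BF-MWSAT: the BF-MWSAT instance with data $(A^+,A^-,b,\varphi,c)$ has as its Boolean feasible vectors exactly the satisfying assignments of $\mathcal{C}$, with the same objective $c^Ty$.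
   Context: A t-norm is a map $\varphi:[0,1]^2\to[0,1]$ that is commutative, associative, non-decreasing in each argument, and satisfies $\varphi(1,z)=z$ for all $z$ (hence $\varphi(0,z)=0$). BF-MWSAT (bipolar fuzzy minimum-weight satisfiability): given matrices $A^+=(a^+_{ij})$, $A^-=(a^-_{ij})\in[0,1]^{m\times n}$, a vector $b\in[0,1]^m$, a continuous t-norm $\varphi$ and costs $c\in\mathbb{R}_{\ge0}^n$, the problem is to minimize $c^Tx$ over $x\in[0,1]^n$ subject to $g_i(x)=b_i$ for all $i=1,\dots,m$, where $g_i(x)=\max_{1\le j\le n}\max\{\varphi(a^+_{ij},x_j),\varphi(a^-_{ij},1-x_j)\}$. $y\models\mathcal{C}$ means that the Boolean vector $y$ satisfies $\mathcal{C}$. An empty clause ($P_i=N_i=\varnothing$) is unsatisfiable, and the maximum over an empty index set is taken to be $0$. *)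

theory Defs
  imports Complex_Main "HOL-Library.FuncSet"
begin

text \<open>
  Vectors of length \<open>n\<close> are functions \<open>nat \<Rightarrow> real\<close> on the index set \<open>{1..n}\<close>; the points of
  \<open>[0,1]\<^sup>n\<close> and \<open>{0,1}\<^sup>n\<close> are taken extensional, so that each vector has exactly one
  representative. The entries of data matrices and vectors outside the index range are never used.
\<close>

definition unit_vectors :: "nat \<Rightarrow> (nat \<Rightarrow> real) set" where
  "unit_vectors n = {1..n} \<rightarrow>\<^sub>E {0..1}"

definition boolean_vectors :: "nat \<Rightarrow> (nat \<Rightarrow> real) set" where
  "boolean_vectors n = {1..n} \<rightarrow>\<^sub>E {0, 1}"

text \<open>
  A t-norm is a binary function on \<open>[0,1]\<close>; it is represented by a total function on the reals whose
  values outside the unit square are irrelevant.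
\<close>

definition t_norm :: "(real \<Rightarrow> real \<Rightarrow> real) \<Rightarrow> bool" where
  "t_norm \<phi> \<longleftrightarrow>
     (\<forall>x\<in>{0..1}. \<forall>y\<in>{0..1}. \<phi> x y \<in> {0..1}) \<and>
     (\<forall>x\<in>{0..1}. \<forall>y\<in>{0..1}. \<phi> x y = \<phi> y x) \<and>
     (\<forall>x\<in>{0..1}. \<forall>y\<in>{0..1}. \<forall>z\<in>{0..1}. \<phi> (\<phi> x y) z = \<phi> x (\<phi> y z)) \<and>
     (\<forall>x\<in>{0..1}. \<forall>x'\<in>{0..1}. \<forall>y\<in>{0..1}. x \<le> x' \<longrightarrow> \<phi> x y \<le> \<phi> x' y \<and> \<phi> y x \<le> \<phi> y x') \<and>
     (\<forall>z\<in>{0..1}. \<phi> 1 z = z)"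

definition continuous_t_norm :: "(real \<Rightarrow> real \<Rightarrow> real) \<Rightarrow> bool" where
  "continuous_t_norm \<phi> \<longleftrightarrow>
     t_norm \<phi> \<and> continuous_on ({0..1} \<times> {0..1}) (\<lambda>(x, y). \<phi> x y)"

text \<open>\<open>Max {}\<close> is unspecified in the library; here the maximum over an empty index set is \<open>0\<close>.\<close>

definition max0 :: "('a \<Rightarrow> real) \<Rightarrow> 'a set \<Rightarrow> real" where
  "max0 f J = (if J = {} then 0 else Max (f ` J))"

definition bipolar_row ::
  "nat \<Rightarrow> (real \<Rightarrow> real \<Rightarrow> real) \<Rightarrow> (nat \<Rightarrow> nat \<Rightarrow> real) \<Rightarrow> (nat \<Rightarrow> nat \<Rightarrow> real)
     \<Rightarrow> nat \<Rightarrow> (nat \<Rightarrow> real) \<Rightarrow> real" where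
  "bipolar_row n \<phi> Ap An i x =
     max0 (\<lambda>j. max (\<phi> (Ap i j) (x j)) (\<phi> (An i j) (1 - x j))) {1..n}"

record min_problem =
  feasible :: "(nat \<Rightarrow> real) set"
  objective :: "(nat \<Rightarrow> real) \<Rightarrow> real"

record bf_mwsat_data =
  rows :: nat
  vars :: nat
  Apos :: "nat \<Rightarrow> nat \<Rightarrow> real"
  Aneg :: "nat \<Rightarrow> nat \<Rightarrow> real"
  rhs :: "nat \<Rightarrow> real"
  tnorm :: "real \<Rightarrow> real \<Rightarrow> real"
  cost :: "nat \<Rightarrow> real"

definition bf_mwsat_instance :: "bf_mwsat_data \<Rightarrow> bool" where
  "bf_mwsat_instance I \<longleftrightarrow>
     (\<forall>i\<in>{1..rows I}. \<forall>j\<in>{1..vars I}. Apos I i j \<in> {0..1} \<and> Aneg I i j \<in> {0..1}) \<and>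
     (\<forall>i\<in>{1..rows I}. rhs I i \<in> {0..1}) \<and>
     continuous_t_norm (tnorm I) \<and>
     (\<forall>j\<in>{1..vars I}. 0 \<le> cost I j)"

definition crisp :: "bf_mwsat_data \<Rightarrow> bool" where
  "crisp I \<longleftrightarrow>
     (\<forall>i\<in>{1..rows I}. \<forall>j\<in>{1..vars I}. Apos I i j \<in> {0, 1} \<and> Aneg I i j \<in> {0, 1}) \<and>
     (\<forall>i\<in>{1..rows I}. rhs I i \<in> {0, 1})"

definition bf_mwsat :: "bf_mwsat_data \<Rightarrow> min_problem" where
  "bf_mwsat I =
     \<lparr>feasible = {x \<in> unit_vectors (vars I).
        \<forall>i\<in>{1..rows I}. bipolar_row (vars I) (tnorm I) (Apos I) (Aneg I) i x = rhs I i},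
      objective = (\<lambda>x. \<Sum>j=1..vars I. cost I j * x j)\<rparr>"

text \<open>
  A CNF formula with \<open>m\<close> clauses is given by the sets \<open>P i\<close> and \<open>N i\<close> of indices of the variables
  occurring positively and negatively in clause \<open>i\<close>.
\<close>

definition sat_clause :: "nat set \<Rightarrow> nat set \<Rightarrow> (nat \<Rightarrow> real) \<Rightarrow> bool" where
  "sat_clause P N y \<longleftrightarrow> (\<exists>j\<in>P. y j = 1) \<or> (\<exists>j\<in>N. \<not> y j = 1)"

definition sat_cnf ::
  "nat \<Rightarrow> (nat \<Rightarrow> nat set) \<Rightarrow> (nat \<Rightarrow> nat set) \<Rightarrow> (nat \<Rightarrow> real) \<Rightarrow> bool" where
  "sat_cnf m P N y \<longleftrightarrow> (\<forall>i\<in>{1..m}. sat_clause (P i) (N i) y)"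

definition mwsat ::
  "nat \<Rightarrow> nat \<Rightarrow> (nat \<Rightarrow> nat set) \<Rightarrow> (nat \<Rightarrow> nat set) \<Rightarrow> (nat \<Rightarrow> real) \<Rightarrow> min_problem" where
  "mwsat m n P N c =
     \<lparr>feasible = {y \<in> boolean_vectors n. sat_cnf m P N y},
      objective = (\<lambda>y. \<Sum>j=1..n. c j * y j)\<rparr>"

definition incidence :: "(nat \<Rightarrow> nat set) \<Rightarrow> nat \<Rightarrow> nat \<Rightarrow> real" where
  "incidence S i j = (if j \<in> S i then 1 else 0)"

definition cnf_data ::
  "nat \<Rightarrow> nat \<Rightarrow> (nat \<Rightarrow> nat set) \<Rightarrow> (nat \<Rightarrow> nat set) \<Rightarrow> (real \<Rightarrow> real \<Rightarrow> real)
     \<Rightarrow> (nat \<Rightarrow> real) \<Rightarrow> bf_mwsat_data" where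
  "cnf_data m n P N \<phi> c =
     \<lparr>rows = m, vars = n, Apos = incidence P, Aneg = incidence N, rhs = (\<lambda>i. 1),
      tnorm = \<phi>, cost = c\<rparr>"

end

theory Submission
  imports Defs
begin

text \<open>
  Crisp data put only \<open>0\<close> and \<open>1\<close> in the first argument of the t-norm. There \<open>1\<close> is the unit, and \<open>0\<close>
  is absorbing, because \<open>0 \<le> \<phi> 0 z = \<phi> z 0 \<le> \<phi> 1 0 = 0\<close> by commutativity and monotonicity. Hence
  every t-norm agrees with multiplication when its first argument is Boolean
  (\<open>t_norm_boolean_left\<close>). For a Boolean vector each entry of row \<open>i\<close> is then the truth value of the
  disjunction of those literals on the \<open>j\<close>-th variable that occur in clause \<open>i\<close>. A maximum of truth
  values is \<open>1\<close> exactly when one of them is, so the row evaluates the clause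
  (\<open>bipolar_row_eq_1_iff_sat_clause\<close>).

  The statement on optimisation problems follows, since Boolean vectors lie in the unit cube and both
  problems minimise the same linear function.
\<close>

lemma t_norm_boolean_left:
  assumes "t_norm \<phi>" "a \<in> {0, 1}" "z \<in> {0..1}"
  shows "\<phi> a z = a * z"
proof (cases "a = 1")
  case True
  then show ?thesis
    using assms by (simp add: t_norm_def)
next
  case False
  then have "a = 0"
    using assms by simp
  have zero: "(0::real) \<in> {0..1}" and one: "(1::real) \<in> {0..1}"
    by auto
  have "\<phi> 0 z = \<phi> z 0"
    using assms(1,3) zero unfolding t_norm_def by blast
  also have "\<phi> z 0 \<le> \<phi> 1 0"
  proof -
    have "z \<le> 1"
      using assms(3) by simp
    then show ?thesis
      using assms(1,3) zero one unfolding t_norm_def by blast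
  qed
  also have "\<phi> 1 0 = 0"
    using assms(1) zero unfolding t_norm_def by blast
  finally have "\<phi> 0 z \<le> 0" .
  moreover have "\<phi> 0 z \<in> {0..1}"
    using assms(1,3) zero unfolding t_norm_def by blast
  ultimately show ?thesis
    using \<open>a = 0\<close> by simp
qed

text \<open>
  A maximum reaches an upper bound only by attaining it. The bound has to be nonzero because the
  maximum over the empty set is \<open>0\<close>; this is the case of a formula without variables, whose
  clauses are all empty.
\<close>

lemma max0_eq_bound_iff:
  assumes "finite J" "\<And>j. j \<in> J \<Longrightarrow> f j \<le> c" "c \<noteq> 0"
  shows "max0 f J = c \<longleftrightarrow> (\<exists>j\<in>J. f j = c)"
proof (cases "J = {}")
  case True
  then show ?thesis
    using assms(3) by (simp add: max0_def)
next
  case False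
  then show ?thesis
    using assms(1,2) by (auto simp: max0_def Max_eq_iff)
qed

lemma bipolar_row_eq_1_iff_sat_clause:
  assumes "t_norm \<phi>" "y \<in> boolean_vectors n" "P i \<subseteq> {1..n}" "N i \<subseteq> {1..n}"
  shows "bipolar_row n \<phi> (incidence P) (incidence N) i y = 1 \<longleftrightarrow> sat_clause (P i) (N i) y"
proof -
  let ?f = "\<lambda>j. max (\<phi> (incidence P i j) (y j)) (\<phi> (incidence N i j) (1 - y j))"
  have bool: "y j \<in> {0, 1}" if "j \<in> {1..n}" for j
    using assms(2) that by (auto simp: boolean_vectors_def)
  have entry: "?f j = (if j \<in> P i \<and> y j = 1 \<or> j \<in> N i \<and> y j \<noteq> 1 then 1 else 0)"
    if "j \<in> {1..n}" for j
  proof -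
    have "y j \<in> {0..1}" "1 - y j \<in> {0..1}"
      using bool[OF that] by auto
    then have "?f j = max (incidence P i j * y j) (incidence N i j * (1 - y j))"
      using t_norm_boolean_left[OF assms(1)] by (simp add: incidence_def)
    then show ?thesis
      using bool[OF that] by (auto simp: incidence_def)
  qed
  have "bipolar_row n \<phi> (incidence P) (incidence N) i y = 1 \<longleftrightarrow> (\<exists>j\<in>{1..n}. ?f j = 1)"
    unfolding bipolar_row_def by (rule max0_eq_bound_iff) (simp_all add: entry)
  also have "\<dots> \<longleftrightarrow> (\<exists>j\<in>{1..n}. j \<in> P i \<and> y j = 1 \<or> j \<in> N i \<and> y j \<noteq> 1)"
    by (intro bex_cong refl) (simp add: entry)
  also have "\<dots> \<longleftrightarrow> sat_clause (P i) (N i) y"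
    using assms(3,4) unfolding sat_clause_def by blast
  finally show ?thesis .
qed

lemma sat_cnf_iff_bipolar_rows_eq_1:
  assumes "\<forall>i\<in>{1..m}. P i \<subseteq> {1..n} \<and> N i \<subseteq> {1..n}" "t_norm \<phi>" "y \<in> boolean_vectors n"
  shows "sat_cnf m P N y \<longleftrightarrow>
    (\<forall>i\<in>{1..m}. bipolar_row n \<phi> (incidence P) (incidence N) i y = 1)"
  using assms by (simp add: sat_cnf_def bipolar_row_eq_1_iff_sat_clause)

lemma boolean_vectors_subset_unit_vectors: "boolean_vectors n \<subseteq> unit_vectors n"
  unfolding boolean_vectors_def unit_vectors_def by (rule PiE_mono) auto

lemma bf_mwsat_instance_cnf_data:
  assumes "continuous_t_norm \<phi>" "\<forall>j\<in>{1..n}. 0 \<le> c j"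
  shows "bf_mwsat_instance (cnf_data m n P N \<phi> c)"
  using assms by (simp add: bf_mwsat_instance_def cnf_data_def incidence_def)

lemma crisp_cnf_data: "crisp (cnf_data m n P N \<phi> c)"
  by (simp add: crisp_def cnf_data_def incidence_def)

lemma boolean_feasible_bf_mwsat_cnf_data:
  assumes "\<forall>i\<in>{1..m}. P i \<subseteq> {1..n} \<and> N i \<subseteq> {1..n}" "t_norm \<phi>"
  shows "feasible (bf_mwsat (cnf_data m n P N \<phi> c)) \<inter> boolean_vectors n =
    feasible (mwsat m n P N c)"
  using boolean_vectors_subset_unit_vectors[of n] sat_cnf_iff_bipolar_rows_eq_1[OF assms]
  by (auto simp: bf_mwsat_def cnf_data_def mwsat_def)

lemma objective_bf_mwsat_cnf_data:
  "objective (bf_mwsat (cnf_data m n P N \<phi> c)) = objective (mwsat m n P N c)"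
  by (simp add: bf_mwsat_def cnf_data_def mwsat_def)

theorem theorem3:
  fixes m n :: nat and P N :: "nat \<Rightarrow> nat set"
  assumes "\<forall>i\<in>{1..m}. P i \<subseteq> {1..n} \<and> N i \<subseteq> {1..n}"
  shows "(\<forall>\<phi> y. t_norm \<phi> \<longrightarrow> y \<in> boolean_vectors n \<longrightarrow>
            (sat_cnf m P N y \<longleftrightarrow>
              (\<forall>i\<in>{1..m}. bipolar_row n \<phi> (incidence P) (incidence N) i y = 1))) \<and>
         (\<forall>\<phi> c. continuous_t_norm \<phi> \<longrightarrow> (\<forall>j\<in>{1..n}. 0 \<le> c j) \<longrightarrow>
            bf_mwsat_instance (cnf_data m n P N \<phi> c) \<and>
            crisp (cnf_data m n P N \<phi> c) \<and>
            feasible (bf_mwsat (cnf_data m n P N \<phi> c)) \<inter> boolean_vectors n =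
              feasible (mwsat m n P N c) \<and>
            (\<forall>y\<in>boolean_vectors n.
              objective (bf_mwsat (cnf_data m n P N \<phi> c)) y = objective (mwsat m n P N c) y))"
proof (intro conjI allI impI)
  fix \<phi> y
  assume "t_norm \<phi>" "y \<in> boolean_vectors n"
  then show "sat_cnf m P N y \<longleftrightarrow>
      (\<forall>i\<in>{1..m}. bipolar_row n \<phi> (incidence P) (incidence N) i y = 1)"
    by (rule sat_cnf_iff_bipolar_rows_eq_1[OF assms])
next
  fix \<phi> :: "real \<Rightarrow> real \<Rightarrow> real" and c :: "nat \<Rightarrow> real"
  assume \<phi>: "continuous_t_norm \<phi>" and c: "\<forall>j\<in>{1..n}. 0 \<le> c j"
  show "bf_mwsat_instance (cnf_data m n P N \<phi> c)"
    using \<phi> c by (rule bf_mwsat_instance_cnf_data)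
  show "crisp (cnf_data m n P N \<phi> c)"
    by (rule crisp_cnf_data)
  have "t_norm \<phi>"
    using \<phi> by (simp add: continuous_t_norm_def)
  then show "feasible (bf_mwsat (cnf_data m n P N \<phi> c)) \<inter> boolean_vectors n =
      feasible (mwsat m n P N c)"
    by (rule boolean_feasible_bf_mwsat_cnf_data[OF assms])
  show "\<forall>y\<in>boolean_vectors n.
      objective (bf_mwsat (cnf_data m n P N \<phi> c)) y = objective (mwsat m n P N c) y"
    by (simp add: objective_bf_mwsat_cnf_data)
qed

end
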